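(* Let $q\ge 1$ be an integer, and let $n$ denote the number of vertices of an SRNT graph with $\lambda_1=q$. (1) If $q\notin\{2,4,5,6,7,8,12,47\}$, then $$4q^3+6q^2\le n\le q^2(q+3)^2,$$ and the lower and upper bounds are attained by feasible parameters when $c=q$ and $c=q(q+1)$ respectively (that is, $(q,q)$ and $(q,q(q+1))$ are feasible, $n_q(q)=4q^3+6q^2$ and $n_q(q(q+1))=q^2(q+3)^2$). (2) If $q\in\{2,5,7,12,47\}$, the lower bound is replaced by $4q^3+6q^2-2(q+1)$, that is, $4q^3+6q^2-2(q+1)\le n\le q^2(q+3)^2$, and this lower bound is attained by feasible parameters when $c=q-1$. (3) If $q\in\{4,6,8\}$, the lower bound is replaced by $4q^3+6q^2-2(q-1)+\frac{12}{q-2}$, that is, $4q^3+6q^2-2(q-1)+\frac{12}{q-2}\le n\le q^2(q+3)^2$, and this lower bound is attained by feasible parameters when $c=q-2$.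
   Context: An SRNT graph (strongly regular graph with no triangles) is a finite simple graph, regular of degree $k$, in which any two adjacent vertices have no common neighbours and any two distinct non-adjacent vertices have exactly $c$ common neighbours, with $k\ge 3$ and $k>c\ge 1$. The eigenvalues of its adjacency matrix are $k$ (with multiplicity 1) and the two roots $\lambda_1>\lambda_2$ of $\lambda^2+c\lambda-(k-c)=0$, which are integers with $\lambda_1>0>\lambda_2$. Writing $q=\lambda_1$, one has $k=c(q+1)+q^2$ and the number of vertices is $n=n_q(c)$, where $$n_q(c)=(q+1)(q+2)\,c+(2q^3+3q^2-q)+\frac{q^4-q^2}{c}.$$ A pair $(q,c)$ of positive integers is called feasible if $1\le c\le q(q+1)$ and the following two conditions hold: (i) $c$ divides $q^4-q^2$; (ii) $c+2q$ divides the integer $q^4+3q^3+5q^2+3q+q\,(q^4-q^2)/c$. A bound is said to be attained by feasible parameters at $c$ if $(q,c)$ is feasible and $n_q(c)$ equals the bound. *)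

theory Defs
  imports "Graph_Theory.Pair_Digraph" "Jordan_Normal_Form.Char_Poly" Complex_Main
begin

(* pair_graph is the library's locale of finite simple graphs: finitely many vertices, no loops,
   and a symmetric arc set, so (u, v) \<in> parcs G means that u and v are adjacent. *)

definition common_neighbours :: "'a pair_pre_digraph \<Rightarrow> 'a \<Rightarrow> 'a \<Rightarrow> 'a set" where
  "common_neighbours G u v = {w \<in> pverts G. (u, w) \<in> parcs G \<and> (v, w) \<in> parcs G}"

(* The graph without vertices is excluded explicitly: it would satisfy all other
   conditions vacuously, for every k > c. *)
definition srnt_graph :: "'a pair_pre_digraph \<Rightarrow> nat \<Rightarrow> nat \<Rightarrow> bool" where
  "srnt_graph G k c \<longleftrightarrow>
     pair_graph G \<and> pverts G \<noteq> {} \<and> k \<ge> 3 \<and> k > c \<and> c \<ge> 1 \<and>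
     (\<forall>v\<in>pverts G. out_degree (with_proj G) v = k) \<and>
     (\<forall>u\<in>pverts G. \<forall>v\<in>pverts G. (u, v) \<in> parcs G \<longrightarrow> common_neighbours G u v = {}) \<and>
     (\<forall>u\<in>pverts G. \<forall>v\<in>pverts G. u \<noteq> v \<and> (u, v) \<notin> parcs G \<longrightarrow>
        card (common_neighbours G u v) = c)"

definition adjacency_mat :: "'a pair_pre_digraph \<Rightarrow> 'a list \<Rightarrow> real mat" where
  "adjacency_mat G vs =
     mat (length vs) (length vs) (\<lambda>(i, j). if (vs ! i, vs ! j) \<in> parcs G then 1 else 0)"

(* The list vs enumerates the vertices. Another enumeration conjugates the adjacency matrix by a
   permutation matrix, so the eigenvalues do not depend on the choice. *)
definition adjacency_eigenvalues :: "'a pair_pre_digraph \<Rightarrow> real set" where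
  "adjacency_eigenvalues G =
     {\<theta>. \<exists>vs. distinct vs \<and> set vs = pverts G \<and> eigenvalue (adjacency_mat G vs) \<theta>}"

(* The eigenvalues of an SRNT graph are k and two others, and lambda1 is the larger of
   those two. *)
definition srnt_lambda1 :: "'a pair_pre_digraph \<Rightarrow> nat \<Rightarrow> real" where
  "srnt_lambda1 G k = Max (adjacency_eigenvalues G - {real k})"

definition srnt_order :: "int \<Rightarrow> int \<Rightarrow> real" where
  "srnt_order q c =
     real_of_int ((q + 1) * (q + 2) * c + (2 * q^3 + 3 * q^2 - q)) +
     real_of_int (q^4 - q^2) / real_of_int c"

(* The div is exact because of the preceding conjunct. *)
definition feasible :: "int \<Rightarrow> int \<Rightarrow> bool" where
  "feasible q c \<longleftrightarrow>
     q \<ge> 1 \<and> 1 \<le> c \<and> c \<le> q * (q + 1) \<and>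
     c dvd q^4 - q^2 \<and>
     c + 2 * q dvd q^4 + 3 * q^3 + 5 * q^2 + 3 * q + q * ((q^4 - q^2) div c)"

definition attained_at :: "int \<Rightarrow> real \<Rightarrow> int \<Rightarrow> bool" where
  "attained_at q b c \<longleftrightarrow> feasible q c \<and> srnt_order q c = b"

end

theory Submission
  imports Defs "Jordan_Normal_Form.Schur_Decomposition"
begin

text \<open>
  Everything rests on showing that an SRNT graph with larger nontrivial eigenvalue \<open>q\<close> has
  feasible parameters \<open>(q, c)\<close> and order \<open>n\<^sub>q(c)\<close>; the bounds are then a matter of
  elementary arithmetic.

  The defining conditions say \<open>A\<^sup>2 = (k - c) I - c A + c J\<close> for the adjacency matrix \<open>A\<close>. On an
  eigenvector with eigenvalue different from \<open>k\<close> the matrix \<open>J\<close> vanishes, so \<open>q\<close> satisfies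
  \<open>q\<^sup>2 + c q = k - c\<close>, and summing a row of the matrix identity then gives
  \<open>c n = (k - q) (k + c + q)\<close>. These two equations are the formula for the order. The remaining information comes from
  the matrix \<open>E = q I - A + g J\<close>, where \<open>g\<close> is chosen so that \<open>E\<close> annihilates the constant
  vectors. Since also \<open>E\<close> annihilates the eigenspace of \<open>q\<close>, it is \<open>c + 2 q\<close> times the orthogonal
  projection onto the eigenspace of the smallest eigenvalue \<open>-(c + q)\<close>; that is,
  \<open>E\<^sup>2 = (c + 2 q) E\<close>, which can be verified without any spectral theory
  (\<open>E_square\<close>). Two consequences are drawn from this.

  \<^item> The trace of an idempotent matrix is its rank, hence a natural number
    (\<open>idempotent_kernel_trace_Nats\<close>). For \<open>E / (c + 2 q)\<close> this is the integrality of the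
    multiplicity of \<open>-(c + q)\<close>, which is equivalent to the second divisibility
    condition of feasibility.
  \<^item> A positive multiple of a projection is a Gram matrix, so the sum of the cubes of its entries is a
    sum of squares (\<open>sum_cubes_nonneg\<close>). For \<open>E\<close> this is one of the Krein conditions,
    and it factors into \<open>c \<le> q (q + 1)\<close> (\<open>krein\<close>).

  For the bounds, \<open>n\<^sub>q\<close> is compared with its value at \<open>c = q\<close> through the factorization
  \<open>c (n\<^sub>q(c) - n\<^sub>q(q)) = (q + 1) (c - q) (c (q + 2) - q (q - 1))\<close>. The right-hand side is negative only
  for \<open>q (q - 1) / (q + 2) < c < q\<close>, and since \<open>q (q - 1) / (q + 2) > q - 3\<close> only \<open>c = q - 1\<close> and
  \<open>c = q - 2\<close> can beat \<open>c = q\<close>. For \<open>c = q - 1\<close> feasibility forces \<open>3 q - 1\<close> to divide \<open>140\<close>, which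
  leaves \<open>q \<in> {2, 5, 7, 12, 47}\<close>. For \<open>c = q - 2\<close> the right-hand side is negative only if \<open>q > 4\<close>;
  feasibility forces \<open>q - 2\<close> to divide \<open>12\<close>, and the second divisibility condition then leaves
  \<open>q \<in> {6, 8}\<close>. At \<open>q = 4\<close> the choices \<open>c = q - 2\<close> and \<open>c = q\<close> give the same order.
\<close>

section \<open>Traces and cubes of idempotent matrices\<close>

lemma sum_in_Nats: "(\<And>i. i \<in> A \<Longrightarrow> f i \<in> \<nat>) \<Longrightarrow> sum f A \<in> \<nat>"
  by (induction A rule: infinite_finite_induct) auto

text \<open>
  An idempotent matrix is similar to an upper triangular one, which is again idempotent. Its diagonal
  entries then satisfy \<open>b = b\<^sup>2\<close>, and similarity preserves the trace.
\<close>

lemma idempotent_mat_trace_Nats: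
  fixes P :: "complex mat"
  assumes P: "P \<in> carrier_mat n n" and idem: "P * P = P"
  shows "(\<Sum>i<n. P $$ (i, i)) \<in> \<nat>"
proof -
  obtain es where "char_poly P = (\<Prod>a\<leftarrow>es. [:- a, 1:])"
    using char_poly_factorized[OF P] by blast
  from schur_decomposition_exists[OF P this]
  obtain B where B: "B \<in> carrier_mat n n" "upper_triangular B" "similar_mat P B" by blast
  then obtain S T where ST: "similar_mat_wit P B S T"
    unfolding similar_mat_def by blast
  note w = similar_mat_witD2[OF P ST]
  have BB: "B * B = B"
  proof -
    have TPS: "T * P * S = B"
    proof -
      have "T * P * S = T * (S * B * T) * S" using w by simp
      also have "\<dots> = (T * S) * B * (T * S)"
        using w(5-7) by (simp add: assoc_mult_mat[of _ n n _ n _ n])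
      finally show ?thesis using w by simp
    qed
    have "B * B = T * P * (S * T) * P * S"
      using w(4-7) by (simp add: TPS[symmetric] assoc_mult_mat[of _ n n _ n _ n] del: w(1))
    also have "\<dots> = T * (P * P) * S"
      using w(1,4-7) by (simp add: assoc_mult_mat[of _ n n _ n _ n] del: idem)
    finally show ?thesis by (simp add: idem TPS)
  qed
  \<comment> \<open>In the product of upper triangular matrices only the middle term of a diagonal entry survives.\<close>
  have diag: "B $$ (i, i) \<in> {0, 1}" if i: "i < n" for i
  proof -
    have "B $$ (i, i) = (\<Sum>j<n. B $$ (i, j) * B $$ (j, i))"
      using i B(1) arg_cong[OF BB, of "\<lambda>M. M $$ (i, i)"]
      by (simp add: scalar_prod_def atLeast0LessThan)
    also have "\<dots> = (\<Sum>j<n. if j = i then B $$ (i, i) * B $$ (i, i) else 0)"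
    proof (rule sum.cong)
      fix j assume "j \<in> {..<n}"
      then show "B $$ (i, j) * B $$ (j, i) = (if j = i then B $$ (i, i) * B $$ (i, i) else 0)"
        using upper_triangularD[OF B(2)] i B(1)
        by (cases j i rule: linorder_cases) auto
    qed simp
    finally have "B $$ (i, i) = B $$ (i, i) * B $$ (i, i)" using i by simp
    then show ?thesis by simp
  qed
  have trace_comm: "(\<Sum>i<n. (X * Y) $$ (i, i)) = (\<Sum>i<n. (Y * X) $$ (i, i))"
    if "X \<in> carrier_mat n n" "Y \<in> carrier_mat n n" for X Y :: "complex mat"
    using that sum.swap[of "\<lambda>i j. X $$ (i, j) * Y $$ (j, i)" "{..<n}" "{..<n}"]
    by (simp add: scalar_prod_def atLeast0LessThan mult.commute)
  have "(\<Sum>i<n. P $$ (i, i)) = (\<Sum>i<n. (S * (B * T)) $$ (i, i))"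
    using w(3) w(4-7) by (simp add: assoc_mult_mat[of _ n n _ n _ n])
  also have "\<dots> = (\<Sum>i<n. ((B * T) * S) $$ (i, i))"
    using w(4-7) by (intro trace_comm) auto
  also have "(B * T) * S = B"
    using w(2,4-7) by (simp add: assoc_mult_mat[of _ n n _ n _ n])
  also have "(\<Sum>i<n. B $$ (i, i)) \<in> \<nat>"
  proof (intro sum_in_Nats)
    fix i assume "i \<in> {..<n}"
    then show "B $$ (i, i) \<in> \<nat>" using diag[of i] by auto
  qed
  finally show ?thesis .
qed

lemma sum_nth_distinct:
  "distinct vs \<Longrightarrow> (\<Sum>i<length vs. f (vs ! i)) = (\<Sum>v\<in>set vs. f v)"
  by (rule sum.reindex_bij_betw[OF bij_betw_nth]) auto

text \<open>
  The same fact for matrices indexed by an arbitrary finite set, so that the graph-theoretic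
  computations below need no enumeration of the vertices.
\<close>

lemma idempotent_kernel_trace_Nats:
  fixes P :: "'a \<Rightarrow> 'a \<Rightarrow> real"
  assumes V: "finite V"
    and idem: "\<And>u v. u \<in> V \<Longrightarrow> v \<in> V \<Longrightarrow> (\<Sum>w\<in>V. P u w * P w v) = P u v"
  shows "(\<Sum>v\<in>V. P v v) \<in> \<nat>"
proof -
  obtain vs where vs: "set vs = V" "distinct vs"
    using finite_distinct_list[OF V] by blast
  define n where "n = length vs"
  define M where "M = mat n n (\<lambda>(i, j). complex_of_real (P (vs ! i) (vs ! j)))"
  have M: "M \<in> carrier_mat n n" by (simp add: M_def)
  have "M * M = M"
  proof (rule eq_matI)
    fix i j assume "i < dim_row M" "j < dim_col M"
    then have ij: "i < n" "j < n" by (auto simp: M_def)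
    then have "(M * M) $$ (i, j)
        = complex_of_real (\<Sum>l<n. P (vs ! i) (vs ! l) * P (vs ! l) (vs ! j))"
      by (simp add: M_def scalar_prod_def atLeast0LessThan)
    also have "(\<Sum>l<n. P (vs ! i) (vs ! l) * P (vs ! l) (vs ! j)) = P (vs ! i) (vs ! j)"
      using idem[of "vs ! i" "vs ! j"] ij vs
        sum_nth_distinct[OF vs(2), of "\<lambda>w. P (vs ! i) w * P w (vs ! j)"]
      by (auto simp: n_def)
    finally show "(M * M) $$ (i, j) = M $$ (i, j)" using ij by (simp add: M_def)
  qed (simp_all add: M_def)
  from idempotent_mat_trace_Nats[OF M this]
  have "(\<Sum>i<n. complex_of_real (P (vs ! i) (vs ! i))) \<in> \<nat>"
    by (simp add: M_def)
  then have "complex_of_real (\<Sum>v\<in>V. P v v) \<in> \<nat>"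
    using sum_nth_distinct[OF vs(2), of "\<lambda>v. P v v"] vs(1) by (simp add: n_def flip: of_real_sum)
  then show ?thesis
    by (metis Nats_cases of_nat_in_Nats of_real_eq_iff of_real_of_nat_eq)
qed

text \<open>
  Let \<open>F\<^sub>u\<close> denote the vector \<open>F u\<close>. The cube of the inner product of \<open>F\<^sub>u\<close> and \<open>F\<^sub>v\<close> is the inner
  product of the third tensor powers of \<open>F\<^sub>u\<close> and \<open>F\<^sub>v\<close>, so both sides are the squared length of the
  sum of these tensor powers over all \<open>u\<close>.
\<close>

lemma sum_cubes_gram:
  fixes F :: "'a \<Rightarrow> 'b \<Rightarrow> real"
  shows "(\<Sum>u\<in>V. \<Sum>v\<in>V. (\<Sum>a\<in>W. F u a * F v a) ^ 3)
       = (\<Sum>a\<in>W. \<Sum>b\<in>W. \<Sum>c\<in>W. (\<Sum>u\<in>V. F u a * F u b * F u c)\<^sup>2)"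
proof -
  let ?g = "\<lambda>u v a b c. (F u a * F u b * F u c) * (F v a * F v b * F v c)"
  have rotate: "(\<Sum>u\<in>V. \<Sum>v\<in>V. \<Sum>a\<in>W. h u v a) = (\<Sum>a\<in>W. \<Sum>u\<in>V. \<Sum>v\<in>V. h u v a)"
    for h :: "'a \<Rightarrow> 'a \<Rightarrow> 'b \<Rightarrow> real"
    by (simp only: sum.swap[where A = V and B = W])
  have "(\<Sum>u\<in>V. \<Sum>v\<in>V. (\<Sum>a\<in>W. F u a * F v a) ^ 3)
      = (\<Sum>u\<in>V. \<Sum>v\<in>V. \<Sum>a\<in>W. \<Sum>b\<in>W. \<Sum>c\<in>W. ?g u v a b c)"
    unfolding power3_eq_cube by (simp add: sum_distrib_left sum_distrib_right mult_ac)
  also have "\<dots> = (\<Sum>a\<in>W. \<Sum>b\<in>W. \<Sum>c\<in>W. \<Sum>u\<in>V. \<Sum>v\<in>V. ?g u v a b c)"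
    by (subst rotate, rule sum.cong[OF refl], subst rotate, rule sum.cong[OF refl], rule rotate)
  also have "\<dots> = (\<Sum>a\<in>W. \<Sum>b\<in>W. \<Sum>c\<in>W. (\<Sum>u\<in>V. F u a * F u b * F u c)\<^sup>2)"
    unfolding power2_eq_square sum_product ..
  finally show ?thesis .
qed

text \<open>
  Up to the positive factor \<open>t\<close>, a symmetric matrix with \<open>E\<^sup>2 = t E\<close> is the Gram matrix of its own rows.
\<close>

lemma sum_cubes_nonneg:
  fixes E :: "'a \<Rightarrow> 'a \<Rightarrow> real"
  assumes sym: "\<And>u v. E u v = E v u" and t: "t > 0"
    and square: "\<And>u v. u \<in> V \<Longrightarrow> v \<in> V \<Longrightarrow> (\<Sum>w\<in>V. E u w * E w v) = t * E u v"
  shows "(\<Sum>u\<in>V. \<Sum>v\<in>V. E u v ^ 3) \<ge> 0"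
proof -
  have "t ^ 3 * (\<Sum>u\<in>V. \<Sum>v\<in>V. E u v ^ 3) = (\<Sum>u\<in>V. \<Sum>v\<in>V. (t * E u v) ^ 3)"
    by (simp add: sum_distrib_left power_mult_distrib)
  also have "\<dots> = (\<Sum>u\<in>V. \<Sum>v\<in>V. (\<Sum>a\<in>V. E u a * E v a) ^ 3)"
    by (intro sum.cong refl) (simp add: square[symmetric] sym)
  also have "\<dots> \<ge> 0" unfolding sum_cubes_gram by (intro sum_nonneg) auto
  finally show ?thesis using t by (simp add: zero_le_mult_iff)
qed

section \<open>The adjacency operator of an SRNT graph\<close>

locale srnt =
  fixes G :: "'a pair_pre_digraph" and k c :: nat
  assumes srnt: "srnt_graph G k c"
begin

abbreviation V :: "'a set" where "V \<equiv> pverts G"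

definition adj :: "'a \<Rightarrow> 'a \<Rightarrow> real" where
  "adj u v = (if (u, v) \<in> parcs G then 1 else 0)"

sublocale pair_graph G using srnt by (simp add: srnt_graph_def)

lemma finite_V [simp]: "finite V" by (rule pair_finite_verts)

lemma params: "V \<noteq> {}" "k \<ge> 3" "k > c" "c \<ge> 1"
  using srnt by (auto simp: srnt_graph_def)

lemma arc_sym: "(u, v) \<in> parcs G \<longleftrightarrow> (v, u) \<in> parcs G"
  using pair_sym_arcs by (auto simp: symmetric_def sym_def)

lemma adj_sym: "adj u v = adj v u" by (simp add: adj_def arc_sym)

lemma adj_self [simp]: "adj u u = 0"
  using pair_no_loops[of "(u, u)"] by (auto simp: adj_def)

lemma card_neighbours: "v \<in> V \<Longrightarrow> card {w \<in> V. (v, w) \<in> parcs G} = k"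
proof -
  assume v: "v \<in> V"
  have "out_arcs (with_proj G) v = Pair v ` {w \<in> V. (v, w) \<in> parcs G}"
    by (auto simp: out_arcs_def dest: in_arcsD2)
  then have "out_degree (with_proj G) v = card {w \<in> V. (v, w) \<in> parcs G}"
    by (simp add: out_degree_def card_image inj_on_def)
  then show ?thesis using srnt v by (simp add: srnt_graph_def)
qed

lemma sum_adj: "v \<in> V \<Longrightarrow> (\<Sum>w\<in>V. adj v w) = k"
  using card_neighbours[of v] by (simp add: adj_def sum.If_cases Int_def)

lemma sum_adj': "v \<in> V \<Longrightarrow> (\<Sum>w\<in>V. adj w v) = k"
  using sum_adj[of v] by (simp add: adj_sym)

text \<open>
  The matrix identity \<open>A\<^sup>2 = (k - c) I - c A + c J\<close>, which encodes regularity, the absence of triangles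
  and the number of common neighbours of non-adjacent vertices all at once.
\<close>

lemma adj_square:
  assumes "u \<in> V" "v \<in> V"
  shows "(\<Sum>w\<in>V. adj u w * adj w v) = (if u = v then real k - c else 0) - c * adj u v + c"
proof -
  have "(\<Sum>w\<in>V. adj u w * adj w v)
      = (\<Sum>w\<in>V. if (u, w) \<in> parcs G \<and> (v, w) \<in> parcs G then 1 else 0)"
    by (intro sum.cong) (auto simp: adj_def arc_sym)
  also have "\<dots> = card (common_neighbours G u v)"
    by (simp add: sum.If_cases Int_def common_neighbours_def)
  also have "\<dots> = (if u = v then real k - c else 0) - c * adj u v + c"
  proof -
    consider "u = v" | "u \<noteq> v" "(u, v) \<in> parcs G" | "u \<noteq> v" "(u, v) \<notin> parcs G" by blast
    then show ?thesis
    proof cases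
      case 1
      then show ?thesis using assms card_neighbours[of v] by (simp add: common_neighbours_def)
    next
      case 2
      then have "common_neighbours G u v = {}" using srnt assms by (auto simp: srnt_graph_def)
      then show ?thesis using 2 by (simp add: adj_def)
    next
      case 3
      then have "card (common_neighbours G u v) = c" using srnt assms by (auto simp: srnt_graph_def)
      then show ?thesis using 3 by (simp add: adj_def)
    qed
  qed
  finally show ?thesis .
qed

text \<open>Both sides come from summing one row of the identity for \<open>A\<^sup>2\<close>.\<close>

lemma order_eq: "real c * card V = real k ^ 2 + real c * k - k + c"
proof -
  obtain u where u: "u \<in> V" using params by auto
  have "(\<Sum>v\<in>V. \<Sum>w\<in>V. adj u w * adj w v) = (\<Sum>w\<in>V. adj u w * (\<Sum>v\<in>V. adj w v))"
    by (subst sum.swap) (simp add: sum_distrib_left)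
  also have "\<dots> = (\<Sum>w\<in>V. adj u w * k)" by (intro sum.cong) (simp_all add: sum_adj)
  also have "\<dots> = real k ^ 2"
    using u by (simp add: sum_adj power2_eq_square flip: sum_distrib_right)
  finally have "real k ^ 2
      = (\<Sum>v\<in>V. (if u = v then real k - c else 0) - c * adj u v + c)"
    using u by (simp add: adj_square)
  also have "\<dots> = real k - c - c * k + c * card V"
    using u by (simp add: sum.distrib sum_subtractf sum_adj flip: sum_distrib_left)
  finally show ?thesis by simp
qed

text \<open>
  Eigenvectors as functions on the vertex set, which frees what follows from the vertex
  enumeration in the definition of the spectrum.
\<close>

lemma eigenvalue_iff:
  "\<theta> \<in> adjacency_eigenvalues G \<longleftrightarrow>
     (\<exists>f. (\<exists>v\<in>V. f v \<noteq> 0) \<and> (\<forall>u\<in>V. (\<Sum>w\<in>V. adj u w * f w) = \<theta> * f u))"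
  (is "?L \<longleftrightarrow> ?R")
proof
  assume ?L
  then obtain vs x where vs: "distinct vs" "set vs = V"
    and x: "eigenvector (adjacency_mat G vs) x \<theta>"
    by (auto simp: adjacency_eigenvalues_def eigenvalue_def)
  define n where "n = length vs"
  have xn: "x \<in> carrier_vec n" "x \<noteq> 0\<^sub>v n" "adjacency_mat G vs *\<^sub>v x = \<theta> \<cdot>\<^sub>v x"
    using x by (auto simp: eigenvector_def adjacency_mat_def n_def)
  have bij: "bij_betw (\<lambda>i. vs ! i) {..<n} V"
    using vs by (intro bij_betw_nth) (auto simp: n_def)
  define f where "f v = x $ (inv_into {..<n} (\<lambda>i. vs ! i) v)" for v
  have f: "f (vs ! i) = x $ i" if "i < n" for i
    using that bij by (simp add: f_def bij_betw_def inv_into_f_f)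
  have "(\<Sum>w\<in>V. adj u w * f w) = \<theta> * f u" if "u \<in> V" for u
  proof -
    from that have "u \<in> set vs" by (simp add: vs(2))
    then obtain i where i: "i < n" "u = vs ! i" unfolding in_set_conv_nth n_def by metis
    have "(\<Sum>w\<in>V. adj u w * f w) = (\<Sum>j<n. adj u (vs ! j) * f (vs ! j))"
      by (rule sum.reindex_bij_betw[OF bij, symmetric])
    also have "\<dots> = (adjacency_mat G vs *\<^sub>v x) $ i"
      using xn(1) i f by (simp add: adjacency_mat_def scalar_prod_def atLeast0LessThan adj_def
          n_def[symmetric])
    also have "\<dots> = \<theta> * f u" using xn(1) i f by (simp add: xn(3))
    finally show ?thesis .
  qed
  moreover have "\<exists>v\<in>V. f v \<noteq> 0"
  proof -
    obtain i where "i < n" "x $ i \<noteq> 0"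
      using xn(1,2) by (metis carrier_vecD eq_vecI index_zero_vec)
    then show ?thesis using f bij by (intro bexI[of _ "vs ! i"]) (auto simp: bij_betw_def)
  qed
  ultimately show ?R by blast
next
  assume ?R
  then obtain f where f: "\<exists>v\<in>V. f v \<noteq> 0"
    "\<And>u. u \<in> V \<Longrightarrow> (\<Sum>w\<in>V. adj u w * f w) = \<theta> * f u" by blast
  obtain vs where vs: "set vs = V" "distinct vs"
    using finite_distinct_list[OF finite_V] by blast
  define n where "n = length vs"
  define x where "x = vec n (\<lambda>i. f (vs ! i))"
  have "eigenvector (adjacency_mat G vs) x \<theta>"
    unfolding eigenvector_def
  proof (intro conjI)
    show "x \<in> carrier_vec (dim_row (adjacency_mat G vs))"
      by (simp add: x_def adjacency_mat_def n_def)
    obtain v where "v \<in> set vs" "f v \<noteq> 0" using f(1) vs(1) by blast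
    then obtain i where "i < n" "f (vs ! i) \<noteq> 0" unfolding in_set_conv_nth n_def by metis
    then show "x \<noteq> 0\<^sub>v (dim_row (adjacency_mat G vs))"
      by (auto simp: x_def adjacency_mat_def n_def vec_eq_iff)
    show "adjacency_mat G vs *\<^sub>v x = \<theta> \<cdot>\<^sub>v x"
    proof (rule eq_vecI)
      fix i assume "i < dim_vec (\<theta> \<cdot>\<^sub>v x)"
      then have i: "i < n" by (simp add: x_def)
      then have "(adjacency_mat G vs *\<^sub>v x) $ i = (\<Sum>j<n. adj (vs ! i) (vs ! j) * f (vs ! j))"
        by (simp add: adjacency_mat_def scalar_prod_def atLeast0LessThan adj_def x_def
            n_def[symmetric])
      also have "\<dots> = (\<Sum>w\<in>V. adj (vs ! i) w * f w)"
        using sum_nth_distinct[OF vs(2), of "\<lambda>w. adj (vs ! i) w * f w"] vs(1) by (simp add: n_def)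
      also have "\<dots> = \<theta> * f (vs ! i)" 
        using nth_mem[of i vs] i vs(1) by (intro f(2)) (simp add: n_def)
      finally show "(adjacency_mat G vs *\<^sub>v x) $ i = (\<theta> \<cdot>\<^sub>v x) $ i" using i by (simp add: x_def)
    qed (simp add: x_def adjacency_mat_def n_def)
  qed
  then show ?L using vs by (auto simp: adjacency_eigenvalues_def eigenvalue_def)
qed


text \<open>On functions of sum zero the term \<open>c J\<close> of \<open>A\<^sup>2\<close> disappears.\<close>

lemma adj_square_apply:
  assumes u: "u \<in> V" and f: "(\<Sum>w\<in>V. f w) = 0"
  shows "(\<Sum>w\<in>V. adj u w * (\<Sum>x\<in>V. adj w x * f x))
       = (real k - c) * f u - c * (\<Sum>w\<in>V. adj u w * f w)"
proof -
  have "(\<Sum>w\<in>V. adj u w * (\<Sum>x\<in>V. adj w x * f x))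
      = (\<Sum>x\<in>V. (\<Sum>w\<in>V. adj u w * adj w x) * f x)"
    unfolding sum_distrib_left sum_distrib_right by (subst sum.swap) (simp add: mult_ac)
  also have "\<dots> = (\<Sum>x\<in>V. (if u = x then (real k - c) * f x else 0)
                  - c * (adj u x * f x) + c * f x)"
  proof (rule sum.cong)
    fix x assume "x \<in> V"
    then show "(\<Sum>w\<in>V. adj u w * adj w x) * f x
        = (if u = x then (real k - c) * f x else 0) - c * (adj u x * f x) + c * f x"
      unfolding adj_square[OF u \<open>x \<in> V\<close>] by (simp add: algebra_simps)
  qed simp
  also have "\<dots> = (real k - c) * f u - c * (\<Sum>w\<in>V. adj u w * f w)"
    using u f by (simp add: sum.distrib sum_subtractf flip: sum_distrib_left)
  finally show ?thesis .
qed

lemma eigenvalue_root: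
  fixes \<theta> :: real
  assumes \<theta>: "\<theta> \<in> adjacency_eigenvalues G" and ne: "\<theta> \<noteq> k"
  shows "\<theta>\<^sup>2 + c * \<theta> = real k - c"
proof -
  obtain f v where v: "v \<in> V" "f v \<noteq> 0"
    and f: "\<And>u. u \<in> V \<Longrightarrow> (\<Sum>w\<in>V. adj u w * f w) = \<theta> * f u"
    using \<theta> unfolding eigenvalue_iff by blast
  \<comment> \<open>The all-ones vector is an eigenvector for \<open>k\<close>, so \<open>f\<close> is orthogonal to it.\<close>
  have "\<theta> * (\<Sum>u\<in>V. f u) = (\<Sum>u\<in>V. \<Sum>w\<in>V. adj u w * f w)"
    unfolding sum_distrib_left by (rule sum.cong) (simp_all only: f)
  also have "\<dots> = (\<Sum>w\<in>V. (\<Sum>u\<in>V. adj u w) * f w)"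
    unfolding sum_distrib_right by (rule sum.swap)
  also have "\<dots> = k * (\<Sum>u\<in>V. f u)" by (simp add: sum_adj' sum_distrib_left)
  finally have zero: "(\<Sum>u\<in>V. f u) = 0" using ne by simp
  have "(\<Sum>w\<in>V. adj v w * (\<Sum>x\<in>V. adj w x * f x)) = (\<Sum>w\<in>V. \<theta> * (adj v w * f w))"
    by (intro sum.cong) (simp_all only: f mult.left_commute)
  also have "\<dots> = \<theta>\<^sup>2 * f v" using v by (simp add: f power2_eq_square flip: sum_distrib_left)
  finally have "\<theta>\<^sup>2 * f v = (real k - c) * f v - c * (\<theta> * f v)"
    using adj_square_apply[OF v(1) zero] v by (simp add: f)
  then have "(\<theta>\<^sup>2 + c * \<theta> - (real k - c)) * f v = 0" by (simp add: algebra_simps)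
  then show ?thesis using v by simp
qed

lemma not_root_k:
  fixes \<theta> :: real
  assumes "\<theta>\<^sup>2 + c * \<theta> = real k - c"
  shows "\<theta> \<noteq> k"
proof -
  have "real k ^ 2 \<ge> real k" using params(2) by (intro self_le_power) auto
  moreover have "real c * k \<ge> 0" by simp
  ultimately have "real k ^ 2 + real c * k > real k - c" using params(4) by linarith
  then show ?thesis using assms by auto
qed

text \<open>
  A maximum is only meaningful for a finite non-empty set. Non-emptiness: let \<open>r\<close> and \<open>s\<close> be the roots
  of the quadratic and \<open>f\<close> a non-zero function of sum zero. Then \<open>(A - r) (A - s) f = 0\<close>, so either
  \<open>(A - s) f\<close> is an eigenvector for \<open>r\<close>, or it vanishes and \<open>f\<close> is an eigenvector for \<open>s\<close>.
\<close>

lemma nontrivial_eigenvalues: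
  "finite (adjacency_eigenvalues G - {real k})" "adjacency_eigenvalues G - {real k} \<noteq> {}"
proof -
  define d where "d = sqrt (real c ^ 2 + 4 * (real k - c))"
  define r s where "r = (- real c + d) / 2" and "s = (- real c - d) / 2"
  have "d\<^sup>2 = real c ^ 2 + 4 * (real k - c)" using params by (simp add: d_def)
  then have rs: "r * s = - (real k - c)"
    by (simp add: r_def s_def power2_eq_square field_simps)
  have sum_rs: "r + s = - real c" by (simp add: r_def s_def field_simps)
  have factor: "\<theta>\<^sup>2 + c * \<theta> - (real k - c) = (\<theta> - r) * (\<theta> - s)" for \<theta> :: real
  proof -
    have "(\<theta> - r) * (\<theta> - s) = \<theta>\<^sup>2 - (r + s) * \<theta> + r * s"
      by (simp add: power2_eq_square algebra_simps)
    then show ?thesis by (simp add: rs sum_rs)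
  qed
  have root_iff: "\<theta>\<^sup>2 + c * \<theta> = real k - c \<longleftrightarrow> \<theta> = r \<or> \<theta> = s" for \<theta> :: real
    using factor[of \<theta>] by auto
  have "adjacency_eigenvalues G - {real k} \<subseteq> {r, s}"
    using eigenvalue_root root_iff by blast
  then show "finite (adjacency_eigenvalues G - {real k})" by (rule finite_subset) simp
  obtain u where u: "u \<in> V" using params by auto
  have "{w \<in> V. (u, w) \<in> parcs G} \<noteq> {}" using card_neighbours[OF u] params by force
  then obtain v where v: "v \<in> V" "u \<noteq> v" using pair_no_loops by force
  define f :: "'a \<Rightarrow> real" where "f w = (if w = u then 1 else 0) - (if w = v then 1 else 0)" for w
  define h where "h w = (\<Sum>x\<in>V. adj w x * f x) - s * f w" for w
  have f0: "(\<Sum>w\<in>V. f w) = 0" using u v by (simp add: f_def sum_subtractf)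
  have h: "(\<Sum>x\<in>V. adj w x * h x) = r * h w" if w: "w \<in> V" for w
  proof -
    define a where "a = (\<Sum>x\<in>V. adj w x * f x)"
    have "(\<Sum>x\<in>V. adj w x * h x)
        = (\<Sum>x\<in>V. adj w x * (\<Sum>y\<in>V. adj x y * f y)) - s * a"
      by (simp add: h_def a_def right_diff_distrib sum_subtractf sum_distrib_left mult_ac)
    also have "\<dots> = (real k - c) * f w - c * a - s * a"
      using adj_square_apply[OF w f0] by (simp add: a_def)
    also have "\<dots> = - (r * s) * f w + (r + s) * a - s * a" by (simp add: rs sum_rs)
    also have "\<dots> = r * h w" by (simp add: h_def a_def algebra_simps)
    finally show ?thesis .
  qed
  show "adjacency_eigenvalues G - {real k} \<noteq> {}"
  proof (cases "\<exists>w\<in>V. h w \<noteq> 0")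
    case True
    then have "r \<in> adjacency_eigenvalues G" using h unfolding eigenvalue_iff by blast
    moreover have "r \<noteq> k" by (rule not_root_k) (simp add: root_iff)
    ultimately show ?thesis by blast
  next
    case False
    then have "\<forall>w\<in>V. (\<Sum>x\<in>V. adj w x * f x) = s * f w" by (simp add: h_def)
    moreover have "f u \<noteq> 0" using v by (simp add: f_def)
    ultimately have "s \<in> adjacency_eigenvalues G" using u unfolding eigenvalue_iff by blast
    moreover have "s \<noteq> k" by (rule not_root_k) (simp add: root_iff)
    ultimately show ?thesis by blast
  qed
qed

lemma lambda1_root:
  "(srnt_lambda1 G k)\<^sup>2 + c * srnt_lambda1 G k = real k - c"
proof -
  have "srnt_lambda1 G k \<in> adjacency_eigenvalues G - {real k}"
    unfolding srnt_lambda1_def by (rule Max_in[OF nontrivial_eigenvalues])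
  then show ?thesis by (intro eigenvalue_root) auto
qed

end

section \<open>The projection onto the eigenspace of the smallest eigenvalue\<close>

locale srnt_root = srnt +
  fixes q :: real
  assumes q_pos: "q > 0" and q_root: "q\<^sup>2 + c * q = real k - c"
begin

text \<open>
  The multiple of \<open>J\<close> for which \<open>E\<close> has vanishing row sums \<open>q - k + n g\<close>, written so as to
  avoid the order \<open>n\<close>.
\<close>

definition g :: real where "g = c / (k + c + q)"

text \<open>The projection onto the eigenspace of \<open>-(c + q)\<close>, multiplied by \<open>c + 2 q\<close>.\<close>

definition E :: "'a \<Rightarrow> 'a \<Rightarrow> real" where
  "E u v = (if u = v then q else 0) - adj u v + g"

lemma order_factor: "real c * card V = (k - q) * (k + c + q)"
  using order_eq q_root by (simp add: algebra_simps power2_eq_square)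

lemma g_mult: "g * (k + c + q) = c"
  using q_pos by (simp add: g_def add_nonneg_pos add.commute)

lemma order_g: "card V * g = k - q"
proof -
  have "(card V * g) * (k + c + q) = (k - q) * (k + c + q)"
    by (simp only: mult.assoc g_mult) (simp only: mult.commute[of "real (card V)"] order_factor)
  moreover have "k + c + q \<noteq> 0" using q_pos by (smt (verit) of_nat_0_le_iff)
  ultimately show ?thesis by (metis mult_right_cancel)
qed

lemma E_square:
  assumes "u \<in> V" "v \<in> V"
  shows "(\<Sum>w\<in>V. E u w * E w v) = (c + 2 * q) * E u v"
proof -
  have "(\<Sum>w\<in>V. E u w * E w v)
      = (\<Sum>w\<in>V. (if w = u then q * E u v else 0) + (if w = v then q * (g - adj u v) else 0)
          + adj u w * adj w v - g * adj u w - g * adj w v + g * g)"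
    by (intro sum.cong) (auto simp: E_def algebra_simps)
  also have "\<dots> = q * E u v + q * (g - adj u v)
      + ((if u = v then real k - c else 0) - c * adj u v + c) - g * k - g * k + card V * g * g"
    using assms by (simp add: sum.distrib sum_subtractf sum_adj sum_adj' adj_square
        flip: sum_distrib_left)
  also have "\<dots> = q * E u v + (if u = v then real k - c else 0) - (c + q) * adj u v + (c + q) * g"
    using g_mult by (simp add: order_g algebra_simps)
  also have "(if u = v then real k - c else 0) = (c + q) * (if u = v then q else 0)"
    using q_root by (simp add: algebra_simps power2_eq_square)
  also have "q * E u v + (c + q) * (if u = v then q else 0) - (c + q) * adj u v + (c + q) * g
      = (c + 2 * q) * E u v"
    by (simp add: E_def algebra_simps)
  finally show ?thesis .
qed

text \<open>The number in question is the multiplicity of the eigenvalue \<open>-(c + q)\<close>.\<close>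

lemma multiplicity_Nats: "(card V * q + k - q) / (c + 2 * q) \<in> \<nat>"
proof -
  have t: "c + 2 * q > 0" using q_pos by (simp add: add_nonneg_pos)
  have "(\<Sum>v\<in>V. E v v / (c + 2 * q)) \<in> \<nat>"
  proof (rule idempotent_kernel_trace_Nats[where P = "\<lambda>u v. E u v / (c + 2 * q)"])
    fix u v assume "u \<in> V" "v \<in> V"
    then show "(\<Sum>w\<in>V. E u w / (c + 2 * q) * (E w v / (c + 2 * q))) = E u v / (c + 2 * q)"
      using t E_square[of u v] by (simp add: divide_simps flip: sum_divide_distrib)
  qed simp
  also have "(\<Sum>v\<in>V. E v v / (c + 2 * q)) = (card V * (q + g)) / (c + 2 * q)"
    by (simp add: E_def)
  also have "card V * (q + g) = card V * q + k - q"
    using order_g by (simp add: algebra_simps)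
  finally show ?thesis .
qed

text \<open>
  All rows of \<open>E\<close> have the same sum of cubes, since \<open>E\<close> has the entry \<open>q + g\<close> on the diagonal, \<open>g - 1\<close>
  at the \<open>k\<close> neighbours and \<open>g\<close> elsewhere. The order is eliminated through \<open>n g = k - q\<close>.
\<close>

lemma krein_raw: "q ^ 3 - k + 3 * (q\<^sup>2 + k) * g - 2 * (k - q) * g\<^sup>2 \<ge> 0"
proof -
  let ?S = "q ^ 3 - k + 3 * (q\<^sup>2 + k) * g - 2 * (k - q) * g\<^sup>2"
  have row: "(\<Sum>v\<in>V. E u v ^ 3) = ?S" if u: "u \<in> V" for u
  proof -
    have "(\<Sum>v\<in>V. E u v ^ 3)
        = (\<Sum>v\<in>V. (if u = v then (q + g) ^ 3 - g ^ 3 else 0) + ((g - 1) ^ 3 - g ^ 3) * adj u v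
            + g ^ 3)"
      by (intro sum.cong) (auto simp: E_def adj_def dest: pair_no_loops)
    also have "\<dots> = (q + g) ^ 3 - g ^ 3 + ((g - 1) ^ 3 - g ^ 3) * k + card V * g * g\<^sup>2"
      using u by (simp add: sum.distrib sum_adj power3_eq_cube power2_eq_square
          flip: sum_distrib_left)
    also have "\<dots> = ?S"
      unfolding order_g by (simp add: algebra_simps power2_eq_square power3_eq_cube)
    finally show ?thesis .
  qed
  have "(\<Sum>u\<in>V. \<Sum>v\<in>V. E u v ^ 3) \<ge> 0"
  proof (rule sum_cubes_nonneg)
    show "c + 2 * q > 0" using q_pos by (simp add: add_nonneg_pos)
    show "E u v = E v u" for u v by (simp add: E_def adj_sym)
  qed (rule E_square)
  then have "card V * ?S \<ge> 0" by (simp add: row)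
  moreover have "card V > 0" using params by (simp add: card_gt_0_iff)
  ultimately show ?thesis by (simp only: zero_le_mult_iff) linarith
qed

text \<open>
  Multiplied by \<open>(k + c + q)\<^sup>2\<close>, the inequality for the cubes becomes a polynomial inequality in \<open>q\<close> and
  \<open>c\<close>, and the polynomial is \<open>q (q + 1) - c\<close> times positive factors.
\<close>

lemma krein: "c \<le> q * (q + 1)"
proof -
  define C where "C = real c"
  have C: "C \<ge> 1" using params by (simp add: C_def)
  have k: "real k = C * (q + 1) + q\<^sup>2" using q_root by (simp add: C_def algebra_simps)
  define w where "w = k + C + q"
  have w: "g * w = C" using g_mult by (simp add: w_def C_def)
  have "0 \<le> w\<^sup>2 * (q ^ 3 - k + 3 * (q\<^sup>2 + k) * g - 2 * (k - q) * g\<^sup>2)"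
    using krein_raw by (intro mult_nonneg_nonneg) auto
  also have "\<dots> = (q ^ 3 - k) * w\<^sup>2 + 3 * (q\<^sup>2 + k) * w * (g * w) - 2 * (k - q) * (g * w)\<^sup>2"
    by (simp add: algebra_simps power2_eq_square)
  also have "\<dots> = (q * (q + 1) - C) * (q * (q + 1) * ((C + (q - 1)) * ((q + 1) * C + q\<^sup>2)))"
    unfolding w unfolding w_def k
    by (simp add: algebra_simps power2_eq_square power3_eq_cube)
  finally have "0 \<le> (q * (q + 1) - C) * (q * (q + 1) * ((C + (q - 1)) * ((q + 1) * C + q\<^sup>2)))" .
  moreover have "q * (q + 1) * ((C + (q - 1)) * ((q + 1) * C + q\<^sup>2)) > 0"
  proof (intro mult_pos_pos)
    show "C + (q - 1) > 0" using q_pos C by linarith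
    show "(q + 1) * C + q\<^sup>2 > 0" using q_pos C by (intro add_pos_pos mult_pos_pos) auto
  qed (use q_pos in auto)
  ultimately have "0 \<le> q * (q + 1) - C"
    by (simp only: zero_le_mult_iff) linarith
  then show ?thesis by (simp add: C_def)
qed

end

section \<open>Parameter arithmetic\<close>

text \<open>
  The quotient \<open>(q\<^sup>4 - q\<^sup>2) / c\<close> is an integer because the order is one and so are all other terms
  of the formula for it. The number in the second condition of feasibility and the numerator
  \<open>n q + k - q\<close> of the multiplicity add up to a multiple of \<open>c + 2 q\<close>, so one is divisible by
  \<open>c + 2 q\<close> if and only if the other is.
\<close>

lemma feasible_of_multiplicity:
  fixes q c n k :: int
  assumes q: "q \<ge> 1" and c: "1 \<le> c" "c \<le> q * (q + 1)"
    and k: "k = c * (q + 1) + q^2"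
    and n: "c * n = (k - q) * (k + c + q)"
    and mult: "c + 2 * q dvd n * q + k - q"
  shows "feasible q c" "srnt_order q c = real_of_int n"
proof -
  define d where "d = n - (q + 1) * (q + 2) * c - (2 * q^3 + 3 * q^2 - q)"
  have b: "q^4 - q^2 = c * d"
    unfolding d_def right_diff_distrib n k
    by (simp add: algebra_simps power2_eq_square power3_eq_cube power4_eq_xxxx)
  then have div: "(q^4 - q^2) div c = d" using c by simp
  have n_d: "n = (q + 1) * (q + 2) * c + (2 * q^3 + 3 * q^2 - q) + d" by (simp add: d_def)
  have "(c + 2 * q) * (d + (q + 1)^3) = (q^4 - q^2) + 2 * q * d + (c + 2 * q) * (q + 1)^3"
    unfolding b by (simp add: algebra_simps)
  then have "q^4 + 3 * q^3 + 5 * q^2 + 3 * q + q * d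
      = (c + 2 * q) * (d + (q + 1)^3) - (n * q + k - q)"
    unfolding k n_d
    by (simp add: algebra_simps power2_eq_square power3_eq_cube power4_eq_xxxx)
  then have "c + 2 * q dvd q^4 + 3 * q^3 + 5 * q^2 + 3 * q + q * d"
    using mult by (metis dvd_diff dvd_triv_left)
  then show "feasible q c" using q c b div by (simp add: feasible_def)
  have "real_of_int (q^4 - q^2) / real_of_int c = real_of_int d"
    unfolding b using c by simp
  then show "srnt_order q c = real_of_int n"
    unfolding srnt_order_def by (simp only: of_int_add[symmetric]) (simp add: d_def)
qed

lemma order_minus_lower:
  fixes q c n :: int
  assumes "1 \<le> c" "srnt_order q c = real_of_int n"
  shows "c * (n - (4 * q^3 + 6 * q^2)) = (q + 1) * (c - q) * (c * (q + 2) - q * (q - 1))"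
proof -
  have "real_of_int c * real_of_int n
      = real_of_int c * real_of_int ((q + 1) * (q + 2) * c + (2 * q^3 + 3 * q^2 - q))
        + real_of_int (q^4 - q^2)"
    using assms(1) unfolding assms(2)[symmetric] srnt_order_def distrib_left by simp
  then have "c * n = c * ((q + 1) * (q + 2) * c + (2 * q^3 + 3 * q^2 - q)) + (q^4 - q^2)"
    by (simp only: of_int_mult[symmetric] of_int_add[symmetric] of_int_eq_iff)
  then have "c * n - c * (4 * q^3 + 6 * q^2)
      = (q + 1) * (c - q) * (c * (q + 2) - q * (q - 1))"
    by (simp add: algebra_simps power2_eq_square power3_eq_cube power4_eq_xxxx)
  then show ?thesis by (simp only: right_diff_distrib)
qed

text \<open>
  The upper bound is the value at \<open>c = q (q + 1)\<close>, so \<open>c\<close> times its difference to \<open>n\<close> contains the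
  factor \<open>q (q + 1) - c\<close>; the cofactor is positive because it increases with \<open>c\<close>.
\<close>

lemma order_le_upper:
  fixes q c n :: int
  assumes "q \<ge> 1" "1 \<le> c" "c \<le> q * (q + 1)" and n: "srnt_order q c = real_of_int n"
  shows "n \<le> q^2 * (q + 3)^2"
proof -
  have "c * (q^2 * (q + 3)^2 - n)
      = c * (q^2 * (q + 3)^2 - (4 * q^3 + 6 * q^2)) - c * (n - (4 * q^3 + 6 * q^2))"
    by (simp add: algebra_simps)
  also have "\<dots> = (q * (q + 1) - c) * ((q + 1) * (q + 2) * c - q * (q - 1))"
    unfolding order_minus_lower[OF assms(2) n]
    by (simp add: algebra_simps power2_eq_square power3_eq_cube)
  also have "\<dots> \<ge> 0"
  proof (rule mult_nonneg_nonneg)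
    have "q * (q - 1) \<le> (q + 1) * (q + 2) * 1"
      using assms(1) by (simp add: algebra_simps)
    also have "\<dots> \<le> (q + 1) * (q + 2) * c" using assms by (intro mult_left_mono) auto
    finally show "0 \<le> (q + 1) * (q + 2) * c - q * (q - 1)" by simp
  qed (use assms in simp)
  finally show ?thesis using assms(2) by (simp add: zero_le_mult_iff)
qed

text \<open>
  The two last factors of the factorization do not have opposite signs unless \<open>c\<close> lies strictly between
  \<open>q (q - 1) / (q + 2)\<close> and \<open>q\<close>. For \<open>c = q - 2\<close> the last factor is \<open>q - 4\<close>, hence the condition
  \<open>q \<le> 4\<close>.
\<close>

lemma order_ge_lower:
  fixes q c n :: int
  assumes q: "q \<ge> 1" and c: "1 \<le> c" and n: "srnt_order q c = real_of_int n"
    and cases: "c \<noteq> q - 1" "c = q - 2 \<Longrightarrow> q \<le> 4"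
  shows "4 * q^3 + 6 * q^2 \<le> n"
proof -
  consider "q \<le> c" | "c = q - 2" "q \<le> 4" | "c \<le> q - 3" using cases by linarith
  then have "(c - q) * (c * (q + 2) - q * (q - 1)) \<ge> 0"
  proof cases
    case 1
    have "q * (q - 1) \<le> q * (q + 2)" using q by (intro mult_left_mono) auto
    also have "\<dots> \<le> c * (q + 2)" using 1 q by (intro mult_right_mono) auto
    finally show ?thesis using 1 by simp
  next
    case 2
    have "c * (q + 2) - q * (q - 1) = q - 4" unfolding 2(1) by (simp add: algebra_simps)
    then show ?thesis using 2 by simp
  next
    case 3
    have "c * (q + 2) \<le> (q - 3) * (q + 2)" using 3 q by (intro mult_right_mono) auto
    also have "\<dots> \<le> q * (q - 1)" by (simp add: algebra_simps)
    finally show ?thesis using 3 by (simp add: zero_le_mult_iff)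
  qed
  then have "(q + 1) * ((c - q) * (c * (q + 2) - q * (q - 1))) \<ge> 0" using q by simp
  then have "c * (n - (4 * q^3 + 6 * q^2)) \<ge> 0"
    unfolding order_minus_lower[OF c n] by (simp only: mult.assoc)
  then show ?thesis using c by (simp add: zero_le_mult_iff)
qed

text \<open>
  Modulo \<open>3 q - 1\<close> the number \<open>3\<close> is invertible with inverse \<open>q\<close>. Multiplying the quartic in \<open>q\<close> by
  \<open>3\<^sup>4\<close> and dividing by \<open>3 q - 1\<close> with remainder shows that \<open>3 q - 1\<close> divides \<open>140\<close>.
\<close>

lemma feasible_pred_imp:
  assumes "feasible q (q - 1)"
  shows "q \<in> {2, 5, 7, 12, 47}"
proof -
  have q: "q \<ge> 2" using assms by (simp add: feasible_def)
  have "q^4 - q^2 = (q - 1) * (q^2 * (q + 1))"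
    by (simp add: algebra_simps power2_eq_square power4_eq_xxxx)
  then have "(q^4 - q^2) div (q - 1) = q^2 * (q + 1)" using q by simp
  then have "3 * q - 1 dvd q^4 + 3 * q^3 + 5 * q^2 + 3 * q + q * (q^2 * (q + 1))"
    using assms by (simp add: feasible_def)
  then have "3 * q - 1 dvd 81 * (q^4 + 3 * q^3 + 5 * q^2 + 3 * q + q * (q^2 * (q + 1)))
      - (3 * q - 1) * (54 * q^3 + 126 * q^2 + 177 * q + 140)"
    by (rule dvd_diff[OF dvd_mult dvd_triv_left])
  also have "\<dots> = 140"
    by (simp add: algebra_simps power2_eq_square power3_eq_cube power4_eq_xxxx)
  finally have dvd: "3 * q - 1 dvd 140" .
  then have "3 * q - 1 \<le> 140" by (rule zdvd_imp_le) simp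
  then have "q \<in> set [2..47]" using q unfolding set_upto atLeastAtMost_iff by linarith
  moreover have "\<forall>q \<in> set [2..47]. 3 * q - 1 dvd (140 :: int) \<longrightarrow> q \<in> {2, 5, 7, 12, 47}"
    by code_simp
  ultimately show ?thesis using dvd by blast
qed

text \<open>
  The remainder of \<open>q\<^sup>4 - q\<^sup>2\<close> modulo \<open>q - 2\<close> is \<open>12\<close>, so only \<open>q \<in> {5, 6, 8, 14}\<close> pass the first
  condition; the second one then excludes \<open>5\<close> and \<open>14\<close>.
\<close>

lemma feasible_pred_pred_imp:
  assumes "feasible q (q - 2)" "q > 4"
  shows "q \<in> {6, 8}"
proof -
  have "q - 2 dvd q^4 - q^2 - (q - 2) * (q^3 + 2 * q^2 + 3 * q + 6)"
    using assms by (intro dvd_diff[OF _ dvd_triv_left]) (simp add: feasible_def)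
  also have "\<dots> = 12"
    by (simp add: algebra_simps power2_eq_square power3_eq_cube power4_eq_xxxx)
  finally have "q - 2 dvd 12" .
  then have "q - 2 \<le> 12" by (rule zdvd_imp_le) simp
  then have "q \<in> set [5..14]"
    using assms(2) unfolding set_upto atLeastAtMost_iff by linarith
  moreover have "\<forall>q \<in> set [5..14]. q - 2 dvd q^4 - q^2 \<and>
      q - 2 + 2 * q dvd q^4 + 3 * q^3 + 5 * q^2 + 3 * q + q * ((q^4 - q^2) div (q - 2))
      \<longrightarrow> q \<in> {6, 8 :: int}"
    by code_simp
  ultimately show ?thesis using assms unfolding feasible_def by blast
qed

lemma attained_at_q:
  fixes q :: int
  assumes "q \<ge> 1"
  shows "attained_at q (real_of_int (4 * q^3 + 6 * q^2)) q"
proof -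
  have b: "q^4 - q^2 = q * (q^3 - q)"
    by (simp add: algebra_simps power2_eq_square power3_eq_cube power4_eq_xxxx)
  \<comment> \<open>Division of the second condition by \<open>3 q\<close> leaves a third of a product of three consecutive integers.\<close>
  have "3 dvd q * (q - 1) * (q + 1)"
  proof -
    have "q mod 3 = 0 \<or> q mod 3 = 1 \<or> q mod 3 = 2" by presburger
    then have "3 dvd q \<or> 3 dvd q - 1 \<or> 3 dvd q + 1" by presburger
    then show ?thesis by auto
  qed
  then obtain m where m: "q * (q - 1) * (q + 1) = 3 * m" by (auto elim: dvdE)
  have "(q + 2 * q) * (2 * m + q^2 + 2 * q + 1) = 2 * q * (3 * m) + 3 * q * (q^2 + 2 * q + 1)"
    by (simp add: algebra_simps)
  then have "q^4 + 3 * q^3 + 5 * q^2 + 3 * q + q * (q^3 - q)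
      = (q + 2 * q) * (2 * m + q^2 + 2 * q + 1)"
    unfolding m[symmetric]
    by (simp add: algebra_simps power2_eq_square power3_eq_cube power4_eq_xxxx)
  then have "q + 2 * q dvd q^4 + 3 * q^3 + 5 * q^2 + 3 * q + q * (q^3 - q)"
    by (simp only: dvd_triv_left)
  moreover have "(q^4 - q^2) div q = q^3 - q" unfolding b using assms by simp
  moreover have "q \<le> q * (q + 1)" using assms by (simp add: algebra_simps)
  moreover have "q dvd q^4 - q^2" unfolding b by (rule dvd_triv_left)
  ultimately have "feasible q q" using assms by (simp only: feasible_def)
  moreover have "srnt_order q q = real_of_int (4 * q^3 + 6 * q^2)"
  proof -
    have "real_of_int (q^4 - q^2) / real_of_int q = real_of_int (q^3 - q)"
      unfolding b of_int_mult using assms by simp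
    then show ?thesis
      unfolding srnt_order_def by (simp add: algebra_simps power2_eq_square power3_eq_cube)
  qed
  ultimately show ?thesis by (simp add: attained_at_def)
qed

lemma attained_at_krein:
  fixes q :: int
  assumes "q \<ge> 1"
  shows "attained_at q (real_of_int (q^2 * (q + 3)^2)) (q * (q + 1))"
proof -
  have pos: "q * (q + 1) > 0" using assms by simp
  have b: "q^4 - q^2 = q * (q + 1) * (q * (q - 1))"
    by (simp add: algebra_simps power2_eq_square power4_eq_xxxx)
  then have "(q^4 - q^2) div (q * (q + 1)) = q * (q - 1)"
    using pos by (metis nonzero_mult_div_cancel_left less_irrefl)
  moreover have "q^4 + 3 * q^3 + 5 * q^2 + 3 * q + q * (q * (q - 1))
      = (q * (q + 1) + 2 * q) * (q^2 + q + 1)"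
    by (simp add: algebra_simps power2_eq_square power3_eq_cube power4_eq_xxxx)
  moreover have "1 \<le> q * (q + 1)" using pos by linarith
  moreover have "q * (q + 1) dvd q^4 - q^2" unfolding b by (rule dvd_triv_left)
  ultimately have "feasible q (q * (q + 1))"
    using assms by (simp only: feasible_def order_refl dvd_triv_left)
  moreover have "srnt_order q (q * (q + 1)) = real_of_int (q^2 * (q + 3)^2)"
  proof -
    have "real_of_int (q^4 - q^2) / real_of_int (q * (q + 1)) = real_of_int (q * (q - 1))"
      unfolding b of_int_mult using assms by simp
    then show ?thesis
      unfolding srnt_order_def
      by (simp add: algebra_simps power2_eq_square power3_eq_cube power4_eq_xxxx)
  qed
  ultimately show ?thesis by (simp add: attained_at_def)
qed

section \<open>The order of an SRNT graph\<close>

text \<open>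
  The equations between reals that the spectral argument provides are equations between integers,
  to which the divisibility arguments apply.
\<close>

lemma srnt_graph_feasible:
  assumes "srnt_graph G k c" "srnt_lambda1 G k = real_of_int q" "q \<ge> 1"
  shows "feasible q (int c)" "srnt_order q (int c) = real (card (pverts G))"
proof -
  interpret srnt G k c using assms(1) by unfold_locales
  interpret srnt_root G k c "real_of_int q"
    using lambda1_root assms by unfold_locales auto
  have "real_of_int (int k) = real_of_int (int c * (q + 1) + q^2)"
    using q_root by (simp add: algebra_simps)
  then have k: "int k = int c * (q + 1) + q^2" by (simp only: of_int_eq_iff)
  have "real_of_int (int c * int (card V)) = real_of_int ((int k - q) * (int k + int c + q))"
    using order_factor by simp
  then have n: "int c * int (card V) = (int k - q) * (int k + int c + q)"
    by (simp only: of_int_eq_iff)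
  have "real_of_int (int c) \<le> real_of_int (q * (q + 1))" using krein by simp
  then have c: "int c \<le> q * (q + 1)" by (simp only: of_int_le_iff)
  obtain m where "(card V * real_of_int q + k - q) / (c + 2 * real_of_int q) = real m"
    using multiplicity_Nats by (auto elim: Nats_cases)
  moreover have "c + 2 * real_of_int q \<noteq> 0" using q_pos by (smt (verit) of_nat_0_le_iff)
  ultimately have "card V * real_of_int q + k - q = m * (c + 2 * real_of_int q)"
    by (simp add: divide_eq_eq)
  then have "real_of_int (int (card V) * q + int k - q) = real_of_int ((int c + 2 * q) * int m)"
    by (simp add: mult.commute)
  then have "int (card V) * q + int k - q = (int c + 2 * q) * int m" by (simp only: of_int_eq_iff)
  then have mult: "int c + 2 * q dvd int (card V) * q + int k - q" by simp
  have "1 \<le> int c" using params by simp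
  from feasible_of_multiplicity[OF assms(3) this c k n mult]
  show "feasible q (int c)" "srnt_order q (int c) = real (card (pverts G))" by simp_all
qed

theorem theorem7:
  fixes q :: int
  assumes "q \<ge> 1"
  shows
    "(q \<notin> {2, 4, 5, 6, 7, 8, 12, 47} \<longrightarrow>
        (\<forall>(G :: 'a pair_pre_digraph) k c.
           srnt_graph G k c \<and> srnt_lambda1 G k = real_of_int q \<longrightarrow>
           4 * q^3 + 6 * q^2 \<le> int (card (pverts G)) \<and>
           int (card (pverts G)) \<le> q^2 * (q + 3)^2) \<and>
        attained_at q (real_of_int (4 * q^3 + 6 * q^2)) q \<and>
        attained_at q (real_of_int (q^2 * (q + 3)^2)) (q * (q + 1))) \<and>
     (q \<in> {2, 5, 7, 12, 47} \<longrightarrow>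
        (\<forall>(G :: 'a pair_pre_digraph) k c.
           srnt_graph G k c \<and> srnt_lambda1 G k = real_of_int q \<longrightarrow>
           4 * q^3 + 6 * q^2 - 2 * (q + 1) \<le> int (card (pverts G)) \<and>
           int (card (pverts G)) \<le> q^2 * (q + 3)^2) \<and>
        attained_at q (real_of_int (4 * q^3 + 6 * q^2 - 2 * (q + 1))) (q - 1)) \<and>
     (q \<in> {4, 6, 8} \<longrightarrow>
        (\<forall>(G :: 'a pair_pre_digraph) k c.
           srnt_graph G k c \<and> srnt_lambda1 G k = real_of_int q \<longrightarrow>
           real_of_int (4 * q^3 + 6 * q^2 - 2 * (q - 1)) + 12 / real_of_int (q - 2)
             \<le> real (card (pverts G)) \<and>
           int (card (pverts G)) \<le> q^2 * (q + 3)^2) \<and>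
        attained_at q
          (real_of_int (4 * q^3 + 6 * q^2 - 2 * (q - 1)) + 12 / real_of_int (q - 2)) (q - 2))"
proof -
  let ?L = "4 * q^3 + 6 * q^2"
  \<comment> \<open>The value \<open>q = 4\<close> does not occur among the exceptions: there \<open>c = q - 2\<close> gives exactly \<open>?L\<close>.\<close>
  have upper: "int (card (pverts G)) \<le> q^2 * (q + 3)^2"
    and lower: "?L \<le> int (card (pverts G)) \<or>
      (q \<in> {2, 5, 7, 12, 47} \<and> int (card (pverts G)) = ?L - 2 * (q + 1)) \<or>
      (q \<in> {6, 8} \<and>
        real (card (pverts G)) = real_of_int (?L - 2 * (q - 1)) + 12 / real_of_int (q - 2))"
    if G: "srnt_graph G k c \<and> srnt_lambda1 G k = real_of_int q"
    for G :: "'a pair_pre_digraph" and k c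
  proof -
    define n where "n = int (card (pverts G))"
    have feas: "feasible q (int c)" and n: "srnt_order q (int c) = real_of_int n"
      using srnt_graph_feasible[of G k c q] G assms by (auto simp: n_def)
    then have c: "1 \<le> int c" "int c \<le> q * (q + 1)" by (auto simp: feasible_def)
    show "int (card (pverts G)) \<le> q^2 * (q + 3)^2"
      using order_le_upper[OF assms c n] by (simp add: n_def)
    note id = order_minus_lower[OF c(1) n]
    consider "int c = q - 1" | "int c = q - 2" "q > 4" | "?L \<le> n"
      using order_ge_lower[OF assms c(1) n] by fastforce
    then show "?L \<le> int (card (pverts G)) \<or>
      (q \<in> {2, 5, 7, 12, 47} \<and> int (card (pverts G)) = ?L - 2 * (q + 1)) \<or>
      (q \<in> {6, 8} \<and>
        real (card (pverts G)) = real_of_int (?L - 2 * (q - 1)) + 12 / real_of_int (q - 2))"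
    proof cases
      case 1
      have "(q - 1) * (n - ?L) = (q - 1) * (- 2 * (q + 1))"
        using id unfolding 1 by (simp add: algebra_simps)
      then have "n - ?L = - 2 * (q + 1)" using c 1 by (simp only: mult_cancel_left) auto
      moreover have "q \<in> {2, 5, 7, 12, 47}" using feas 1 feasible_pred_imp by metis
      ultimately show ?thesis by (simp add: n_def)
    next
      case 2
      have "(q - 2) * (n - (?L - 2 * (q - 1))) = 12"
        using id unfolding 2(1) by (simp add: algebra_simps)
      then have "real_of_int (q - 2) * (real_of_int n - real_of_int (?L - 2 * (q - 1))) = 12"
        by (metis of_int_diff of_int_mult of_int_numeral)
      then have "real_of_int n = real_of_int (?L - 2 * (q - 1)) + 12 / real_of_int (q - 2)"
        using 2(2) by (simp add: field_simps)
      moreover have "q \<in> {6, 8}" using feas 2 feasible_pred_pred_imp by metis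
      ultimately show ?thesis by (simp add: n_def)
    qed (simp add: n_def)
  qed
  have "?L \<le> int (card (pverts G))"
    if "q \<notin> {2, 4, 5, 6, 7, 8, 12, 47}" "srnt_graph G k c \<and> srnt_lambda1 G k = real_of_int q"
    for G :: "'a pair_pre_digraph" and k c
    using lower[OF that(2)] that(1) by blast
  moreover have "?L - 2 * (q + 1) \<le> int (card (pverts G))"
    if "q \<in> {2, 5, 7, 12, 47}" "srnt_graph G k c \<and> srnt_lambda1 G k = real_of_int q"
    for G :: "'a pair_pre_digraph" and k c
    using lower[OF that(2)] that(1) by auto
  moreover have "real_of_int (?L - 2 * (q - 1)) + 12 / real_of_int (q - 2)
      \<le> real (card (pverts G))"
    if "q \<in> {4, 6, 8}" "srnt_graph G k c \<and> srnt_lambda1 G k = real_of_int q"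
    for G :: "'a pair_pre_digraph" and k c
    using lower[OF that(2)] that(1) by auto
  moreover have "attained_at q (real_of_int (?L - 2 * (q + 1))) (q - 1)"
    if "q \<in> {2, 5, 7, 12, 47}"
    using that by (auto simp: attained_at_def feasible_def srnt_order_def)
  moreover have "attained_at q
      (real_of_int (?L - 2 * (q - 1)) + 12 / real_of_int (q - 2)) (q - 2)"
    if "q \<in> {4, 6, 8}"
    using that by (auto simp: attained_at_def feasible_def srnt_order_def)
  ultimately show ?thesis
    using upper attained_at_q[OF assms] attained_at_krein[OF assms] by blast
qed

end
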